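(* For every $\epsilon>0$ there exists $\alpha_0=\alpha_0(\epsilon)\in(0,1)$ such that for every $0<\alpha<\alpha_0$ there exists $N=N(\epsilon,\alpha)$ such that for every $n\ge N$ there are $n$ $p$-values satisfying the PRDN property (with some choice of null set) for which the BH procedure at level $\alpha$ satisfies $$\mathrm{FDR}>(1-\epsilon)\left(\alpha+\alpha\log\frac1\alpha\right).$$
   Context: The $p$-values $p_1,\dots,p_n$ are $[0,1]$-valued random variables. A subset $\mathcal N_0\subset\{1,\dots,n\}$ of size $n_0\ge1$ indexes the true null hypotheses; the corresponding $p$-values are the null $p$-values, each stochastically larger than or equal to the uniform variable on $(0,1)$. The non-null $p$-values may be arbitrary $[0,1]$-valued random variables, arbitrarily dependent on the null ones. BH procedure at level $\alpha$: with ordered $p$-values $p_{(1)}\le\cdots\le p_{(n)}$, let $R=\max\{1\le j\le n:p_{(j)}\le\alpha j/n\}$ ($\max\emptyset=0$) and reject the $R$ hypotheses with $p_j\le\alpha R/n$ (none if $R=0$). With $V$ the number of rejected null $p$-values, $\mathrm{FDR}=\mathbb E[V/\max\{R,1\}]$. PRDN (positive regression dependence within nulls): a (measurable) set $D\subset[0,1]^{n_0}$ is increasing if $x\in D$ and $x\preceq y\preceq 1$ coordinatewise imply $y\in D$. The $p$-values satisfy PRDN if for every increasing set $D\subset[0,1]^{n_0}$ and every $i\in\mathcal N_0$, $\mathbb P\big((p_j)_{j\in\mathcal N_0}\in D\mid p_i\le t\big)$ is non-decreasing in $t\in(0,1]$ (considered for those $t$ with $\mathbb P(p_i\le t)>0$).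 *)

theory Defs
  imports "HOL-Probability.Probability"
begin

definition stochastically_ge_uniform :: "'a measure \<Rightarrow> ('a \<Rightarrow> real) \<Rightarrow> bool" where
  "stochastically_ge_uniform M X \<longleftrightarrow>
     (\<forall>t. cdf (distr M borel X) t \<le> cdf (uniform_measure lborel {0<..<1}) t)"

(* The p-values and hypotheses are indexed by {1..n}; values of p outside this range are
   irrelevant. *)
definition p_values :: "'a measure \<Rightarrow> nat \<Rightarrow> nat set \<Rightarrow> (nat \<Rightarrow> 'a \<Rightarrow> real) \<Rightarrow> bool" where
  "p_values M n N0 p \<longleftrightarrow>
     prob_space M \<and> N0 \<subseteq> {1..n} \<and> N0 \<noteq> {} \<and>
     (\<forall>i\<in>{1..n}. p i \<in> borel_measurable M \<and> (\<forall>\<omega>\<in>space M. p i \<omega> \<in> {0..1})) \<and>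
     (\<forall>i\<in>N0. stochastically_ge_uniform M (p i))"

(* The cube [0,1]^I is the set of extensional functions PiE I {0..1}. *)
definition increasing_set :: "nat set \<Rightarrow> (nat \<Rightarrow> real) set \<Rightarrow> bool" where
  "increasing_set I D \<longleftrightarrow>
     D \<in> sets (PiM I (\<lambda>_. borel)) \<and> D \<subseteq> (I \<rightarrow>\<^sub>E {0..1}) \<and>
     (\<forall>x\<in>D. \<forall>y\<in>(I \<rightarrow>\<^sub>E {0..1}). (\<forall>i\<in>I. x i \<le> y i) \<longrightarrow> y \<in> D)"

definition PRDN :: "'a measure \<Rightarrow> nat set \<Rightarrow> (nat \<Rightarrow> 'a \<Rightarrow> real) \<Rightarrow> bool" where
  "PRDN M N0 p \<longleftrightarrow>
     (\<forall>D. increasing_set N0 D \<longrightarrow> (\<forall>i\<in>N0.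
        mono_on {t \<in> {0<..1}. \<P>(\<omega> in M. p i \<omega> \<le> t) > 0}
          (\<lambda>t. \<P>(\<omega> in M. (\<lambda>j\<in>N0. p j \<omega>) \<in> D \<bar> p i \<omega> \<le> t))))"

(* In the following, x is the vector of observed p-values x 1, ..., x n. *)

definition order_stat :: "nat \<Rightarrow> (nat \<Rightarrow> real) \<Rightarrow> nat \<Rightarrow> real" where
  "order_stat n x j = sort (map x [1..<n + 1]) ! (j - 1)"

definition BH_count :: "nat \<Rightarrow> real \<Rightarrow> (nat \<Rightarrow> real) \<Rightarrow> nat" where
  "BH_count n \<alpha> x = Max (insert 0 {j \<in> {1..n}. order_stat n x j \<le> \<alpha> * real j / real n})"

definition BH_rejected :: "nat \<Rightarrow> real \<Rightarrow> (nat \<Rightarrow> real) \<Rightarrow> nat set" where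
  "BH_rejected n \<alpha> x =
     (if BH_count n \<alpha> x = 0 then {}
      else {i \<in> {1..n}. x i \<le> \<alpha> * real (BH_count n \<alpha> x) / real n})"

definition BH_FDP :: "nat \<Rightarrow> real \<Rightarrow> nat set \<Rightarrow> (nat \<Rightarrow> real) \<Rightarrow> real" where
  "BH_FDP n \<alpha> N0 x =
     real (card (BH_rejected n \<alpha> x \<inter> N0)) / real (max (BH_count n \<alpha> x) 1)"

definition BH_FDR ::
    "'a measure \<Rightarrow> nat \<Rightarrow> real \<Rightarrow> nat set \<Rightarrow> (nat \<Rightarrow> 'a \<Rightarrow> real) \<Rightarrow> real" where
  "BH_FDR M n \<alpha> N0 p = prob_space.expectation M (\<lambda>\<omega>. BH_FDP n \<alpha> N0 (\<lambda>i. p i \<omega>))"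

end

(* A non-null p-value that is small exactly when the nulls are not turns the nulls against the
   procedure.  Take m = n - K independent uniform nulls and K about delta/alpha non-nulls, the r-th
   of which is 0 if no null lies below alpha r/n and 1 otherwise.  If k \<le> K is least such that some
   null is at most alpha k/n, then k - 1 non-nulls vanish and the others equal 1, so at least k
   hypotheses are rejected, at most k - 1 of them non-null: the false discovery proportion is at
   least 1/k.  The minimum of the nulls lies below alpha k/n with probability about alpha k, and
   summation by parts gives an FDR of about the sum of alpha/(k + 1) over k \<le> K, which is
   alpha log(1/alpha) up to O(alpha).  Independent nulls are PRDN because a section of an increasing
   set in direction i is an up-set of the line. *)

theory Submission
  imports Defs
begin

section \<open>The BH procedure by counting, and measurability of the false discovery
  proportion\<close>

text \<open>Sorting preserves the number of entries up to \<open>t\<close>, and in a sorted list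
  these form an initial segment. This turns order statistics into cardinalities.\<close>

lemma order_stat_le_iff:
  assumes "j \<in> {1..n}"
  shows "order_stat n x j \<le> t \<longleftrightarrow> j \<le> card {i \<in> {1..n}. x i \<le> t}"
proof -
  define xs where "xs = sort (map x [1..<n + 1])"
  have len: "length xs = n" and sorted: "sorted xs"
    by (simp_all add: xs_def)
  have "card {i \<in> {1..n}. x i \<le> t} = length (filter (\<lambda>i. x i \<le> t) [1..<n + 1])"
    by (subst distinct_card[symmetric]) (auto intro!: arg_cong[of _ _ card])
  also have "\<dots> = size (filter_mset (\<lambda>y. y \<le> t) (mset (map x [1..<n + 1])))"
    by (simp add: filter_map o_def flip: mset_filter del: mset_map)
  also have "\<dots> = size (filter_mset (\<lambda>y. y \<le> t) (mset xs))"
    by (simp add: xs_def)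
  also have "\<dots> = length (filter (\<lambda>y. y \<le> t) xs)"
    by (simp flip: mset_filter)
  also have "\<dots> = card {k. k < n \<and> xs ! k \<le> t}"
    by (simp add: length_filter_conv_card len)
  finally have card: "card {i \<in> {1..n}. x i \<le> t} = card {k. k < n \<and> xs ! k \<le> t}" .
  show ?thesis
  proof
    assume "order_stat n x j \<le> t"
    then have "xs ! (j - 1) \<le> t"
      by (simp add: order_stat_def xs_def)
    moreover have "xs ! k \<le> xs ! (j - 1)" if "k < j" for k
      using sorted_nth_mono[OF sorted, of k "j - 1"] that assms len by simp
    ultimately have "{..<j} \<subseteq> {k. k < n \<and> xs ! k \<le> t}"
      using assms by fastforce
    then have "card {..<j} \<le> card {k. k < n \<and> xs ! k \<le> t}"
      by (intro card_mono) auto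
    then show "j \<le> card {i \<in> {1..n}. x i \<le> t}"
      by (simp only: card card_lessThan)
  next
    assume le: "j \<le> card {i \<in> {1..n}. x i \<le> t}"
    show "order_stat n x j \<le> t"
    proof (rule ccontr)
      assume "\<not> order_stat n x j \<le> t"
      then have gt: "t < xs ! (j - 1)"
        by (simp add: order_stat_def xs_def)
      have "{k. k < n \<and> xs ! k \<le> t} \<subseteq> {..<j - 1}"
      proof safe
        fix k assume "k < n" "xs ! k \<le> t"
        then show "k < j - 1"
          using sorted_nth_mono[OF sorted, of "j - 1" k] gt len by (cases "j - 1 \<le> k") auto
      qed
      then have "card {k. k < n \<and> xs ! k \<le> t} \<le> j - 1"
        using card_mono[of "{..<j - 1}"] by fastforce
      then show False
        using le assms card by auto
    qed
  qed
qed

lemma BH_count_eq_Max: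
  "BH_count n \<alpha> x =
     Max (insert 0 {j \<in> {1..n}. j \<le> card {i \<in> {1..n}. x i \<le> \<alpha> * real j / real n}})"
  unfolding BH_count_def
  by (intro arg_cong[of _ _ Max] arg_cong[of _ _ "insert 0"]) (auto simp: order_stat_le_iff)

lemma BH_count_le: "BH_count n \<alpha> x \<le> n"
  unfolding BH_count_def by (subst Max_le_iff) auto

lemma BH_count_ge:
  assumes "k \<in> {1..n}" "k \<le> card {i \<in> {1..n}. x i \<le> \<alpha> * real k / real n}"
  shows "k \<le> BH_count n \<alpha> x"
  unfolding BH_count_eq_Max by (rule Max_ge) (use assms in auto)

text \<open>The maximum is attained, so a positive count satisfies its own counting condition, and
  the indices counted there are the rejected ones.\<close>

lemma card_BH_rejected_ge: "BH_count n \<alpha> x \<le> card (BH_rejected n \<alpha> x)"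
proof (cases "BH_count n \<alpha> x = 0")
  case False
  have "BH_count n \<alpha> x \<in>
      insert 0 {j \<in> {1..n}. j \<le> card {i \<in> {1..n}. x i \<le> \<alpha> * real j / real n}}"
    unfolding BH_count_eq_Max by (rule Max_in) auto
  with False show ?thesis
    by (auto simp: BH_rejected_def)
qed auto

text \<open>With count R \<ge> k and at most k - 1 non-null rejections, V \<ge> R - k + 1. The ratio
  (R - k + 1) / R is non-decreasing in R and equals 1 / k at R = k.\<close>

lemma BH_FDP_ge:
  assumes "0 < k" "k \<le> BH_count n \<alpha> x" "card (BH_rejected n \<alpha> x - N0) < k"
  shows "1 / real k \<le> BH_FDP n \<alpha> N0 x"
proof -
  let ?R = "BH_count n \<alpha> x" and ?A = "BH_rejected n \<alpha> x"
  have fin: "finite ?A"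
    by (simp add: BH_rejected_def)
  have "card ?A = card (?A \<inter> N0) + card (?A - N0)"
    using card_Int_Diff[OF fin, of N0] by simp
  then have "?R + 1 \<le> card (?A \<inter> N0) + k"
    using assms(3) card_BH_rejected_ge[of n \<alpha> x] by linarith
  then have *: "real ?R + 1 \<le> real (card (?A \<inter> N0)) + real k"
    by linarith
  have "real ?R \<le> real k * (real ?R + 1 - real k)"
  proof -
    \<comment> \<open>This product is the difference of the two sides of the claim.\<close>
    have "0 \<le> (real k - 1) * (real ?R - real k)"
      using assms by (intro mult_nonneg_nonneg) auto
    then show ?thesis by (simp add: algebra_simps)
  qed
  also have "\<dots> \<le> real k * real (card (?A \<inter> N0))"
    using * by (intro mult_left_mono) auto
  finally show ?thesis
    using assms by (simp add: BH_FDP_def field_simps max_def)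
qed

lemma BH_FDP_nonneg: "0 \<le> BH_FDP n \<alpha> N0 x"
  by (simp add: BH_FDP_def)

text \<open>Count and rejected set depend on the vector only through finitely many threshold
  comparisons; measurability rests on this.\<close>

lemma BH_FDP_cong:
  assumes "\<And>i j. i \<in> {1..n} \<Longrightarrow> j \<in> {1..n} \<Longrightarrow>
    x i \<le> \<alpha> * real j / real n \<longleftrightarrow> y i \<le> \<alpha> * real j / real n"
  shows "BH_FDP n \<alpha> N0 x = BH_FDP n \<alpha> N0 y"
proof -
  have "{i \<in> {1..n}. x i \<le> \<alpha> * real j / real n} = {i \<in> {1..n}. y i \<le> \<alpha> * real j / real n}"
    if "j \<in> {1..n}" for j
    using assms that by auto
  note sets_eq = this
  have R: "BH_count n \<alpha> x = BH_count n \<alpha> y"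
    unfolding BH_count_eq_Max
    by (intro arg_cong[of _ _ Max] arg_cong[of _ _ "insert 0"] Collect_cong)
       (metis (no_types, lifting) sets_eq)
  \<comment> \<open>A count of 0 is a separate case, since the hypothesis covers only thresholds
    with \<open>j\<close> at least 1.\<close>
  have "BH_rejected n \<alpha> x = BH_rejected n \<alpha> y"
    using sets_eq[of "BH_count n \<alpha> y"] BH_count_le[of n \<alpha> y]
    by (cases "BH_count n \<alpha> y = 0") (auto simp: BH_rejected_def R)
  then show ?thesis
    by (simp add: BH_FDP_def R)
qed

text \<open>A crude bound, enough for integrability over a probability space.\<close>

lemma BH_FDP_le: "BH_FDP n \<alpha> N0 x \<le> real n"
proof -
  have "card (BH_rejected n \<alpha> x \<inter> N0) \<le> card {1..n}"
    by (intro card_mono) (auto simp: BH_rejected_def)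
  then have "real (card (BH_rejected n \<alpha> x \<inter> N0)) \<le> real n * real (max (BH_count n \<alpha> x) 1)"
    by (metis card_atLeastAtMost diff_Suc_1 max.cobounded2 mult_le_mono of_nat_le_iff of_nat_mult
        nat_mult_1_right)
  then show ?thesis
    by (simp add: BH_FDP_def divide_le_eq)
qed

text \<open>The random set has finitely many values, and each is cut out by finitely many events and
  complements of events.\<close>

lemma measurable_Collect_finite:
  assumes "finite S" "\<And>s. s \<in> S \<Longrightarrow> {\<omega> \<in> space M. P s \<omega>} \<in> sets M"
  shows "(\<lambda>\<omega>. {s \<in> S. P s \<omega>}) \<in> measurable M (count_space (Pow S))"
proof -
  have "(\<lambda>\<omega>. {s \<in> S. P s \<omega>}) -` {T} \<inter> space M \<in> sets M" if "T \<subseteq> S" for T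
  proof -
    have "(\<lambda>\<omega>. {s \<in> S. P s \<omega>}) -` {T} \<inter> space M = {\<omega> \<in> space M. \<forall>s\<in>S. P s \<omega> \<longleftrightarrow> s \<in> T}"
      using that by auto
    also have "\<dots> \<in> sets M"
    proof (rule sets.sets_Collect_finite_All[OF _ assms(1)])
      fix s assume s: "s \<in> S"
      show "{\<omega> \<in> space M. P s \<omega> \<longleftrightarrow> s \<in> T} \<in> sets M"
        using assms(2)[OF s] sets.sets_Collect_neg[OF assms(2)[OF s]] by (cases "s \<in> T") auto
    qed
    finally show ?thesis .
  qed
  then show ?thesis
    using assms(1) by (subst measurable_count_space_eq2) auto
qed

lemma borel_measurable_BH_FDP:
  assumes "\<And>i. i \<in> {1..n} \<Longrightarrow> p i \<in> borel_measurable M"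
  shows "(\<lambda>\<omega>. BH_FDP n \<alpha> N0 (\<lambda>i. p i \<omega>)) \<in> borel_measurable M"
proof -
  define S where "S = {1..n} \<times> {1..n}"
  define B where "B x = {s \<in> S. x (fst s) \<le> \<alpha> * real (snd s) / real n}" for x :: "nat \<Rightarrow> real"
  \<comment> \<open>\<open>SOME\<close> chooses a vector with comparison pattern \<open>T\<close>;
    on patterns that no vector realizes the value is immaterial. Any \<open>G\<close> is measurable
    on a discrete space.\<close>
  define G where "G T = BH_FDP n \<alpha> N0 (SOME y. B y = T)" for T
  have "(\<lambda>\<omega>. B (\<lambda>i. p i \<omega>)) \<in> measurable M (count_space (Pow S))"
    unfolding B_def
  proof (rule measurable_Collect_finite)
    show "{\<omega> \<in> space M. p (fst s) \<omega> \<le> \<alpha> * real (snd s) / real n} \<in> sets M" if "s \<in> S" for s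
    proof -
      have [measurable]: "p (fst s) \<in> borel_measurable M"
        using that by (intro assms) (auto simp: S_def)
      show ?thesis
        by measurable
    qed
  qed (simp add: S_def)
  then have "(\<lambda>\<omega>. G (B (\<lambda>i. p i \<omega>))) \<in> borel_measurable M"
    by (rule measurable_compose[where g = G]) simp
  moreover have "G (B x) = BH_FDP n \<alpha> N0 x" for x
    unfolding G_def
  proof (rule BH_FDP_cong)
    have "B (SOME y. B y = B x) = B x"
      by (rule someI[where P = "\<lambda>y. B y = B x"]) simp
    then show "(SOME y. B y = B x) i \<le> \<alpha> * real j / real n \<longleftrightarrow> x i \<le> \<alpha> * real j / real n"
      if "i \<in> {1..n}" "j \<in> {1..n}" for i j
      using that unfolding B_def S_def set_eq_iff by auto
  qed
  ultimately show ?thesis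
    by simp
qed

section \<open>PRDN for independent nulls with a common law\<close>

text \<open>Fix the coordinates other than \<open>i\<close>. If the section of \<open>D\<close> has
  a point up to \<open>s\<close>, it contains everything above \<open>s\<close>, so from
  \<open>s\<close> to \<open>t\<close> numerator and denominator of the conditional probability gain
  the same mass, which cannot lower a ratio of at most 1. Integrating the cross-multiplied
  inequality over the other coordinates gives the claim.\<close>

lemma PRDN_PiM:
  assumes I: "finite I" and U: "prob_space U" "space U \<subseteq> {0..1}"
    and id [measurable]: "(\<lambda>u. u) \<in> borel_measurable U"
    and p: "\<And>i \<omega>. i \<in> I \<Longrightarrow> p i \<omega> = \<omega> i"
  shows "PRDN (PiM I (\<lambda>_. U)) I p"
  unfolding PRDN_def
proof (intro allI impI ballI)
  fix D i assume D: "increasing_set I D" and i: "i \<in> I"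
  interpret U: prob_space U by fact
  interpret product_prob_space "\<lambda>_. U" I ..
  let ?P = "PiM I (\<lambda>_. U)"
  define J where "J = I - {i}"
  have IJ: "I = insert i J" "finite J" "i \<notin> J"
    using I i by (auto simp: J_def)
  have [measurable]: "D \<in> sets (PiM I (\<lambda>_. borel))"
    and up: "\<And>x y. x \<in> D \<Longrightarrow> y \<in> I \<rightarrow>\<^sub>E {0..1} \<Longrightarrow> (\<And>j. j \<in> I \<Longrightarrow> x j \<le> y j) \<Longrightarrow> y \<in> D"
    using D by (auto simp: increasing_set_def)
  have [measurable]: "(\<lambda>\<omega>. \<omega> j) \<in> borel_measurable ?P" if "j \<in> I" for j
    using that by measurable
  define A where "A t = {\<omega> \<in> space ?P. (\<lambda>j\<in>I. \<omega> j) \<in> D \<and> \<omega> i \<le> t}" for t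
  have A [measurable]: "A t \<in> sets ?P" for t
    unfolding A_def using i by measurable
  define F where "F t = U.prob {u \<in> space U. u \<le> t}" for t
  have F: "prob {\<omega> \<in> space ?P. \<omega> i \<le> t} = F t" for t
  proof -
    have [measurable]: "{u \<in> space U. u \<le> t} \<in> sets U"
      by measurable
    have "F t = measure (distr ?P U (\<lambda>\<omega>. \<omega> i)) {u \<in> space U. u \<le> t}"
      using i by (simp add: F_def PiM_component)
    also have "\<dots> = prob {\<omega> \<in> space ?P. \<omega> i \<le> t}"
      using i by (subst measure_distr) (auto intro!: arg_cong[of _ _ prob] simp: space_PiM)
    finally show ?thesis ..
  qed
  \<comment> \<open>The probability of \<open>A t\<close> given that the other coordinates are
    \<open>x\<close>.\<close>
  define h where "h t x = U.prob {u \<in> space U. x(i := u) \<in> A t}" for t x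
  have upd: "(\<lambda>u. x(i := u)) \<in> measurable U ?P" if "x \<in> space (PiM J (\<lambda>_. U))" for x
    by (rule measurable_fun_upd[where J = J]) (use that IJ in auto)
  have sec: "{u \<in> space U. x(i := u) \<in> A t} \<in> sets U"
    if "x \<in> space (PiM J (\<lambda>_. U))" for x t
    using measurable_sets[OF upd[OF that] A[of t]] by (simp add: vimage_def Int_def conj_commute)
  have nn_h: "(\<integral>\<^sup>+u. indicator (A t) (x(i := u)) \<partial>U) = ennreal (h t x)"
    if "x \<in> space (PiM J (\<lambda>_. U))" for x t
  proof -
    have "(\<integral>\<^sup>+u. indicator (A t) (x(i := u)) \<partial>U) =
        (\<integral>\<^sup>+u. indicator {u \<in> space U. x(i := u) \<in> A t} u \<partial>U)"
      by (rule nn_integral_cong) (auto simp: indicator_def)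
    then show ?thesis
      using sec[OF that] by (simp add: h_def U.emeasure_eq_measure)
  qed
  have h_nonneg: "0 \<le> h t x" for t x
    by (simp add: h_def)
  have h_meas: "(\<lambda>x. ennreal (h t x)) \<in> borel_measurable (PiM J (\<lambda>_. U))" for t
  proof -
    have "(\<lambda>(x, u). x(i := u)) \<in> measurable (PiM J (\<lambda>_. U) \<Otimes>\<^sub>M U) ?P"
      unfolding IJ(1) by (rule measurable_add_dim)
    from measurable_compose[OF this borel_measurable_indicator[OF A[of t]]]
    have "(\<lambda>(x, u). indicator (A t) (x(i := u)) :: ennreal)
        \<in> borel_measurable (PiM J (\<lambda>_. U) \<Otimes>\<^sub>M U)"
      by (simp add: case_prod_unfold)
    then have "(\<lambda>x. \<integral>\<^sup>+u. indicator (A t) (x(i := u)) \<partial>U) \<in> borel_measurable (PiM J (\<lambda>_. U))"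
      by (rule U.borel_measurable_nn_integral)
    then show ?thesis
      by (simp add: nn_h cong: measurable_cong)
  qed
  have PA: "emeasure ?P (A t) = (\<integral>\<^sup>+x. ennreal (h t x) \<partial>PiM J (\<lambda>_. U))" for t
  proof -
    have "emeasure ?P (A t) = (\<integral>\<^sup>+\<omega>. indicator (A t) \<omega> \<partial>?P)"
      by simp
    also have "\<dots> = (\<integral>\<^sup>+x. \<integral>\<^sup>+u. indicator (A t) (x(i := u)) \<partial>U \<partial>PiM J (\<lambda>_. U))"
      unfolding IJ(1) by (rule product_nn_integral_insert[OF IJ(2,3)]) (simp flip: IJ(1))
    finally show ?thesis
      by (simp add: nn_h cong: nn_integral_cong)
  qed
  \<comment> \<open>The inequality is cross-multiplied so that it survives integration in
    \<open>x\<close> and needs no positivity of \<open>F\<close>.\<close>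
  have h: "h s x * F t \<le> h t x * F s" if st: "s \<le> t" and x: "x \<in> space (PiM J (\<lambda>_. U))" for s t x
  proof (cases "{u \<in> space U. x(i := u) \<in> A s} = {}")
    case True
    then have "h s x = 0"
      unfolding h_def by (simp only: measure_empty)
    then show ?thesis
      by (simp add: h_def F_def)
  next
    case False
    have space: "x(i := u) \<in> space ?P" if "u \<in> space U" for u
      using measurable_space[OF upd[OF x] that] .
    have A_iff: "x(i := u) \<in> A t \<longleftrightarrow> x(i := u) \<in> D \<and> u \<le> t" if "u \<in> space U" for u t
      using space[OF that] i by (simp add: A_def space_PiM)
    obtain u0 where u0: "u0 \<in> space U" "x(i := u0) \<in> D" "u0 \<le> s"
      using False A_iff by auto
    have D: "x(i := u) \<in> D" if "u \<in> space U" "s < u" for u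
      by (rule up[OF u0(2)]) (use space[OF that(1)] U(2) u0(3) that(2) in \<open>force simp: space_PiM\<close>)+
    have meas: "{u \<in> space U. s < u \<and> u \<le> t} \<in> sets U" "{u \<in> space U. u \<le> s} \<in> sets U"
      by measurable
    have "{u \<in> space U. x(i := u) \<in> A t} =
        {u \<in> space U. x(i := u) \<in> A s} \<union> {u \<in> space U. s < u \<and> u \<le> t}"
      using st D by (auto simp: A_iff)
    then have ht: "h t x = h s x + U.prob {u \<in> space U. s < u \<and> u \<le> t}"
      unfolding h_def using sec[OF x] meas
      by (simp only:) (rule U.finite_measure_Union, auto simp: A_iff)
    have "{u \<in> space U. u \<le> t} = {u \<in> space U. u \<le> s} \<union> {u \<in> space U. s < u \<and> u \<le> t}"
      using st by auto
    then have Ft: "F t = F s + U.prob {u \<in> space U. s < u \<and> u \<le> t}"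
      unfolding F_def using meas by (simp only:) (rule U.finite_measure_Union, auto)
    have "h s x \<le> F s"
      unfolding h_def F_def using meas by (intro U.finite_measure_mono) (auto simp: A_iff)
    \<comment> \<open>Once the common gain is substituted for \<open>h t x\<close> and
      \<open>F t\<close>, this is all that remains of the claim.\<close>
    then have "h s x * U.prob {u \<in> space U. s < u \<and> u \<le> t} \<le>
        F s * U.prob {u \<in> space U. s < u \<and> u \<le> t}"
      by (intro mult_right_mono) auto
    then show ?thesis
      unfolding ht Ft by (simp add: algebra_simps)
  qed
  have key: "prob (A s) * F t \<le> prob (A t) * F s" if "s \<le> t" for s t
  proof -
    have "ennreal (F t) * emeasure ?P (A s) = (\<integral>\<^sup>+x. ennreal (F t * h s x) \<partial>PiM J (\<lambda>_. U))"
      unfolding PA by (subst nn_integral_cmult[symmetric]) (simp_all add: h_meas ennreal_mult F_def h_nonneg)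
    also have "\<dots> \<le> (\<integral>\<^sup>+x. ennreal (F s * h t x) \<partial>PiM J (\<lambda>_. U))"
      using h[OF that] by (intro nn_integral_mono ennreal_leI) (simp add: mult.commute)
    also have "\<dots> = ennreal (F s) * emeasure ?P (A t)"
      unfolding PA by (subst nn_integral_cmult[symmetric]) (simp_all add: h_meas ennreal_mult F_def h_nonneg)
    finally show ?thesis
      by (simp add: emeasure_eq_measure F_def mult.commute flip: ennreal_mult)
  qed
  have cond: "\<P>(\<omega> in ?P. (\<lambda>j\<in>I. p j \<omega>) \<in> D \<bar> p i \<omega> \<le> t) = prob (A t) / F t" for t
    using i p by (simp add: cond_prob_def A_def flip: F cong: restrict_cong)
  have F': "\<P>(\<omega> in ?P. p i \<omega> \<le> t) = F t" for t
    using i p by (simp flip: F)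
  show "mono_on {t \<in> {0<..1}. \<P>(\<omega> in ?P. p i \<omega> \<le> t) > 0}
          (\<lambda>t. \<P>(\<omega> in ?P. (\<lambda>j\<in>I. p j \<omega>) \<in> D \<bar> p i \<omega> \<le> t))"
    unfolding cond F'
    by (rule mono_onI) (use key in \<open>simp add: frac_le_eq divide_le_0_iff pos_divide_le_eq pos_le_divide_eq\<close>)
qed


section \<open>Independent uniform variables\<close>

text \<open>Restricting the space itself, not only the mass, to the open interval keeps coordinates
  in [0,1] at every sample point, as \<open>p_values\<close> and \<open>PRDN_PiM\<close>
  demand.\<close>

abbreviation unif :: "real measure" where
  "unif \<equiv> restrict_space lborel {0<..<1}"

lemma measure_unif: "A \<subseteq> {0<..<1} \<Longrightarrow> measure unif A = measure lborel A"
  by (rule measure_restrict_space) auto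

lemma prob_space_unif: "prob_space unif"
  by (rule prob_spaceI) (simp add: space_restrict_space emeasure_restrict_space)

lemma borel_measurable_unif: "(\<lambda>u. u) \<in> borel_measurable unif"
  by (rule measurable_restrict_space1) simp

lemma stochastically_ge_uniform_PiM_unif:
  assumes "i \<in> I"
  shows "stochastically_ge_uniform (PiM I (\<lambda>_. unif)) (\<lambda>\<omega>. \<omega> i)"
  unfolding stochastically_ge_uniform_def
proof
  fix t :: real
  have meas: "(\<lambda>\<omega>. \<omega> i) \<in> measurable (PiM I (\<lambda>_. unif)) unif"
    using assms by measurable
  \<comment> \<open>The law of a coordinate is known with target \<open>unif\<close>, whereas the
    definition asks for target \<open>borel\<close>; hence the detour through two image
    measures.\<close>
  have "distr (PiM I (\<lambda>_. unif)) borel (\<lambda>\<omega>. \<omega> i) =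
      distr (distr (PiM I (\<lambda>_. unif)) unif (\<lambda>\<omega>. \<omega> i)) borel (\<lambda>u. u)"
    by (subst distr_distr[OF borel_measurable_unif meas]) (simp add: o_def)
  also have "\<dots> = distr unif borel (\<lambda>u. u)"
    using assms by (subst distr_PiM_component) (simp_all add: prob_space_unif)
  finally have "cdf (distr (PiM I (\<lambda>_. unif)) borel (\<lambda>\<omega>. \<omega> i)) t = measure unif ({0<..<1} \<inter> {..t})"
    by (simp add: cdf_def measure_distr borel_measurable_unif space_restrict_space Int_commute)
  also have "\<dots> = measure lborel ({0<..<1} \<inter> {..t})"
    by (rule measure_unif) auto
  also have "\<dots> = cdf (uniform_measure lborel {0<..<1}) t"
    by (simp add: cdf_def)
  finally show "cdf (distr (PiM I (\<lambda>_. unif)) borel (\<lambda>\<omega>. \<omega> i)) t \<le> cdf (uniform_measure lborel {0<..<1}) t"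
    by simp
qed

text \<open>The complementary event is a box, whose measure is a product.\<close>

lemma prob_ex_le_PiM_unif:
  assumes "finite I" "0 \<le> t" "t \<le> 1"
  shows "\<P>(\<omega> in PiM I (\<lambda>_. unif). \<exists>i\<in>I. \<omega> i \<le> t) = 1 - (1 - t) ^ card I"
proof -
  interpret U: prob_space unif by (rule prob_space_unif)
  interpret product_prob_space "\<lambda>_. unif" I ..
  let ?P = "PiM I (\<lambda>_. unif)"
  have A: "{t<..<1} \<in> sets unif"
    using assms by (auto simp: sets_restrict_space_iff)
  have box: "(I \<rightarrow>\<^sub>E {t<..<1}) \<in> sets ?P"
    using assms A by (intro sets_PiM_I_finite) auto
  have "emeasure ?P (I \<rightarrow>\<^sub>E {t<..<1}) = (\<Prod>i\<in>I. emeasure unif {t<..<1})"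
    using assms A by (intro emeasure_PiM) auto
  also have "emeasure unif {t<..<1} = ennreal (1 - t)"
    using assms by (subst emeasure_restrict_space) auto
  finally have "prob (I \<rightarrow>\<^sub>E {t<..<1}) = (1 - t) ^ card I"
    using assms by (simp add: measure_def ennreal_power)
  moreover have "\<omega> \<in> (I \<rightarrow>\<^sub>E {t<..<1}) \<longleftrightarrow> (\<forall>i\<in>I. t < \<omega> i)" if "\<omega> \<in> space ?P" for \<omega>
    using that by (auto simp: space_PiM space_restrict_space PiE_iff)
  then have "{\<omega> \<in> space ?P. \<exists>i\<in>I. \<omega> i \<le> t} = space ?P - (I \<rightarrow>\<^sub>E {t<..<1})"
    by (auto simp: not_le[symmetric])
  ultimately show ?thesis
    using prob_compl[OF box] by simp
qed

section \<open>Two elementary estimates\<close>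

lemma one_minus_power_ge:
  fixes t :: real
  assumes "0 \<le> t" "t \<le> 1"
  shows "real m * t / (1 + real m * t) \<le> 1 - (1 - t) ^ m"
proof -
  have "(1 - t) ^ m * (1 + real m * t) \<le> (1 - t) ^ m * (1 + t) ^ m"
    using assms Bernoulli_inequality[of t m] by (intro mult_left_mono) auto
  also have "\<dots> = (1 - t\<^sup>2) ^ m"
    by (simp add: power2_eq_square algebra_simps flip: power_mult_distrib)
  also have "\<dots> \<le> 1"
    using assms by (intro power_le_one) (auto simp: power_le_one)
  finally have "(1 - t) ^ m * (1 + real m * t) \<le> 1" .
  moreover have "0 < 1 + real m * t"
    using assms by (intro add_pos_nonneg) auto
  ultimately show ?thesis
    by (simp add: pos_divide_le_eq left_diff_distrib)
qed

text \<open>The terms telescope as 1/l - 1/(l + 1). They are the weights that perform the summation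
  by parts.\<close>

lemma sum_inverse_pronic_le:
  assumes "0 < k"
  shows "(\<Sum>l=k..K. 1 / (real l * (real l + 1))) \<le> 1 / real k"
proof (cases "k \<le> K")
  case True
  then have "(\<Sum>l=k..K. 1 / (real l * (real l + 1))) = 1 / real k - 1 / (real K + 1)"
  proof (induction K rule: dec_induct)
    case base
    then show ?case using assms by (simp add: field_simps)
  next
    case (step K)
    have "1 / (real (Suc K) * (real (Suc K) + 1)) = 1 / (real K + 1) - 1 / (real (Suc K) + 1)"
      by (simp add: field_simps)
    with step show ?case
      by (simp only: sum.nat_ivl_Suc' le_SucI)
  qed
  then show ?thesis
    by simp
qed auto

section \<open>The adversarial p-values and their false discovery rate\<close>

text \<open>Index \<open>m + r\<close> is the \<open>r\<close>-th non-null. With \<open>c\<close>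
  equal to \<alpha> / n, its trigger \<open>c * r\<close> is the \<open>r\<close>-th BH
  threshold.\<close>

definition adversarial_p :: "nat \<Rightarrow> real \<Rightarrow> nat \<Rightarrow> (nat \<Rightarrow> real) \<Rightarrow> real" where
  "adversarial_p m c i \<omega> =
     (if i \<le> m then \<omega> i else if \<exists>j\<in>{1..m}. \<omega> j \<le> c * real (i - m) then 1 else 0)"

text \<open>The events \<open>E k\<close> grow with \<open>k\<close>, so the weights from the first
  one onwards sum to at most 1 / k. The bound is linear in indicators, so its expectation needs only
  the probabilities of the single events.\<close>

lemma BH_FDP_adversarial_ge:
  fixes \<omega> :: "nat \<Rightarrow> real"
  assumes \<alpha>: "0 < \<alpha>" "\<alpha> < 1" and n: "n = m + K"
  defines "E \<equiv> \<lambda>k. \<exists>j\<in>{1..m}. \<omega> j \<le> \<alpha> / real n * real k"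
  shows "(\<Sum>k=1..K. 1 / (real k * (real k + 1)) * of_bool (E k))
    \<le> BH_FDP n \<alpha> {1..m} (\<lambda>i. adversarial_p m (\<alpha> / real n) i \<omega>)"
    (is "?S \<le> BH_FDP n \<alpha> _ ?x")
proof (cases "\<exists>k\<in>{1..K}. E k")
  case False
  then have "?S = 0"
    by (intro sum.neutral) auto
  then show ?thesis
    using BH_FDP_nonneg by simp
next
  case True
  define k where "k = (LEAST k. k \<in> {1..K} \<and> E k)"
  have k: "k \<in> {1..K}" "E k"
    using True LeastI_ex[of "\<lambda>k. k \<in> {1..K} \<and> E k"] unfolding k_def by blast+
  have least: "k \<le> l" if "l \<in> {1..K}" "E l" for l
    unfolding k_def by (rule Least_le) (use that in auto)
  have mono: "E l" if "k \<le> l" for l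
  proof -
    have "\<alpha> / real n * real k \<le> \<alpha> / real n * real l"
      using that \<alpha> by (intro mult_left_mono) auto
    then show ?thesis
      using k(2) unfolding E_def by (meson order_trans)
  qed
  obtain j where j: "j \<in> {1..m}" "\<omega> j \<le> \<alpha> / real n * real k"
    using k(2) by (auto simp: E_def)
  have "?S \<le> (\<Sum>l=1..K. if k \<le> l then 1 / (real l * (real l + 1)) else 0)"
    by (intro sum_mono) (use least in auto)
  also have "\<dots> = (\<Sum>l\<in>{l \<in> {1..K}. k \<le> l}. 1 / (real l * (real l + 1)))"
    by (rule sum.inter_filter[symmetric]) simp
  also have "{l \<in> {1..K}. k \<le> l} = {k..K}"
    using k by auto
  also have "(\<Sum>l=k..K. 1 / (real l * (real l + 1))) \<le> 1 / real k"
    using k by (intro sum_inverse_pronic_le) auto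
  also have "\<dots> \<le> BH_FDP n \<alpha> {1..m} ?x"
  proof (rule BH_FDP_ge)
    \<comment> \<open>The k - 1 non-nulls before the first triggered one are 0; the null
      \<open>j\<close> completes a set of k small p-values.\<close>
    have "insert j {m + 1..<m + k} \<subseteq> {i \<in> {1..n}. ?x i \<le> \<alpha> * real k / real n}"
    proof -
      have "?x i = 0" if "i \<in> {m + 1..<m + k}" for i
      proof -
        have "\<not> E (i - m)"
          using least[of "i - m"] that k(1) by fastforce
        then show ?thesis
          using that by (auto simp: adversarial_p_def E_def)
      qed
      moreover have "?x j \<le> \<alpha> * real k / real n"
        using j by (simp add: adversarial_p_def)
      moreover have "0 \<le> \<alpha> * real k / real n"
        using \<alpha> by simp
      ultimately have "?x i \<le> \<alpha> * real k / real n" if "i \<in> insert j {m + 1..<m + k}" for i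
        using that by auto
      moreover have "insert j {m + 1..<m + k} \<subseteq> {1..n}"
        using j k n by auto
      ultimately show ?thesis
        by blast
    qed
    then have "card (insert j {m + 1..<m + k}) \<le> card {i \<in> {1..n}. ?x i \<le> \<alpha> * real k / real n}"
      by (intro card_mono) auto
    moreover have "card (insert j {m + 1..<m + k}) = k"
      using j k by (subst card_insert_disjoint) auto
    ultimately show "k \<le> BH_count n \<alpha> ?x"
      using k n by (intro BH_count_ge) auto
    have "BH_rejected n \<alpha> ?x - {1..m} \<subseteq> {m + 1..<m + k}"
    proof
      fix i assume i: "i \<in> BH_rejected n \<alpha> ?x - {1..m}"
      then have "i \<in> {1..n}" and "m < i" and "?x i \<le> \<alpha> * real (BH_count n \<alpha> ?x) / real n"
        by (auto simp: BH_rejected_def split: if_splits)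
      then have "0 < real n"
        by simp
      \<comment> \<open>Since \<alpha> < 1, the rejection threshold stays below 1, so no triggered
        non-null is rejected.\<close>
      have "\<alpha> * real (BH_count n \<alpha> ?x) \<le> \<alpha> * real n"
        using \<alpha> BH_count_le[of n \<alpha> ?x] by (intro mult_left_mono) auto
      also have "\<dots> < 1 * real n"
        using \<alpha> \<open>0 < real n\<close> by (intro mult_strict_right_mono)
      finally have "\<alpha> * real (BH_count n \<alpha> ?x) / real n < 1"
        using \<open>0 < real n\<close> by (subst pos_divide_less_eq) auto
      with \<open>?x i \<le> _\<close> have "?x i < 1"
        by (rule le_less_trans)
      then have "\<not> E (i - m)"
        using \<open>m < i\<close> by (auto simp: adversarial_p_def E_def split: if_splits)
      then have "i - m < k"
        using mono not_le by blast
      then show "i \<in> {m + 1..<m + k}"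
        using \<open>m < i\<close> by auto
    qed
    then have "card (BH_rejected n \<alpha> ?x - {1..m}) \<le> card {m + 1..<m + k}"
      by (intro card_mono) auto
    then show "card (BH_rejected n \<alpha> ?x - {1..m}) < k"
      using k by auto
  qed (use k in auto)
  finally show ?thesis .
qed


lemma p_values_adversarial:
  assumes "0 < m" "m \<le> n"
  shows "p_values (PiM {1..m} (\<lambda>_. unif)) n {1..m} (adversarial_p m c)"
proof -
  let ?P = "PiM {1..m} (\<lambda>_. unif)"
  have comp [measurable]: "(\<lambda>\<omega>. \<omega> j) \<in> borel_measurable ?P" if "j \<in> {1..m}" for j
    using measurable_PiM_component_rev[OF that borel_measurable_unif] by simp
  have "adversarial_p m c i \<in> borel_measurable ?P" if "i \<in> {1..n}" for i
  proof (cases "i \<le> m")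
    case True
    then show ?thesis
      using comp[of i] that by (simp add: adversarial_p_def[abs_def])
  next
    case False
    have "(\<lambda>\<omega>. if \<exists>j\<in>{1..m}. \<omega> j \<le> c * real (i - m) then 1 else 0) \<in> borel_measurable ?P"
      by measurable
    also have "(\<lambda>\<omega>. if \<exists>j\<in>{1..m}. \<omega> j \<le> c * real (i - m) then 1 else 0) = adversarial_p m c i"
      using False unfolding adversarial_p_def fun_eq_iff by simp
    finally show ?thesis .
  qed
  moreover have "adversarial_p m c i \<omega> \<in> {0..1}" if "i \<in> {1..n}" "\<omega> \<in> space ?P" for i \<omega>
    using that by (auto simp: adversarial_p_def space_PiM PiE_iff space_restrict_space less_imp_le)
  moreover have "stochastically_ge_uniform ?P (adversarial_p m c i)" if "i \<in> {1..m}" for i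
    using stochastically_ge_uniform_PiM_unif[OF that] that by (simp add: adversarial_p_def[abs_def])
  ultimately show ?thesis
    using assms by (auto simp: p_values_def intro!: prob_space_PiM prob_space_unif)
qed

text \<open>PRDN looks only at the nulls, where \<open>adversarial_p\<close> is the coordinate
  projection.\<close>

lemma PRDN_adversarial: "PRDN (PiM {1..m} (\<lambda>_. unif)) {1..m} (adversarial_p m c)"
  by (rule PRDN_PiM)
     (auto simp: adversarial_p_def space_restrict_space intro: prob_space_unif borel_measurable_unif)

text \<open>Expectations of the pointwise bound: \<open>E k\<close> has probability at least m
  \<alpha> k / n up to the factor 1 + \<delta>, its k cancels against the weight, and a harmonic sum
  is left.\<close>

lemma BH_FDR_adversarial_ge:
  assumes \<alpha>: "0 < \<alpha>" "\<alpha> < 1" and n: "n = m + K" and m: "0 < m" and \<delta>: "\<alpha> * real K \<le> \<delta>"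
  shows "\<alpha> * (real m / real n) / (1 + \<delta>) * (ln (real K + 2) - 1)
    \<le> BH_FDR (PiM {1..m} (\<lambda>_. unif)) n \<alpha> {1..m} (adversarial_p m (\<alpha> / real n))"
proof -
  let ?P = "PiM {1..m} (\<lambda>_. unif)" and ?p = "adversarial_p m (\<alpha> / real n)"
  let ?c = "\<lambda>k. 1 / (real k * (real k + 1))"
  interpret prob_space ?P
    by (intro prob_space_PiM prob_space_unif)
  define E where "E k = {\<omega> \<in> space ?P. \<exists>j\<in>{1..m}. \<omega> j \<le> \<alpha> / real n * real k}" for k
  have E [measurable]: "E k \<in> events" for k
  proof -
    have [measurable]: "(\<lambda>\<omega>. \<omega> j) \<in> borel_measurable ?P" if "j \<in> {1..m}" for j
      using measurable_PiM_component_rev[OF that borel_measurable_unif] by simp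
    show ?thesis
      unfolding E_def by measurable
  qed
  have int: "integrable ?P (\<lambda>\<omega>. ?c k * indicator (E k) \<omega>)" for k
    by (intro integrable_mult_right integrable_real_indicator E) (simp only: emeasure_eq_measure ennreal_less_top infinity_ennreal_def)
  have prob_E_eq: "expectation (indicator (E k)) = prob (E k)" for k
    by (simp only: Bochner_Integration.integral_indicator sets.Int_space_eq2[OF E])
  have \<delta>0: "0 \<le> \<delta>"
    using \<delta> \<alpha> by (smt (verit) mult_nonneg_nonneg of_nat_0_le_iff)
  have prob_E: "real m * (\<alpha> / real n * real k) / (1 + \<delta>) \<le> prob (E k)" if "k \<in> {1..K}" for k
  proof -
    let ?t = "\<alpha> / real n * real k"
    have "\<alpha> * real k \<le> 1 * real n"
      using that \<alpha> n by (intro mult_mono) auto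
    then have t: "0 \<le> ?t" "?t \<le> 1"
      using \<alpha> n m by (auto simp: field_simps)
    have "real m * ?t \<le> real n * ?t"
      using t n by (intro mult_right_mono) auto
    also have "\<dots> = \<alpha> * real k"
      using n m by simp
    also have "\<dots> \<le> \<alpha> * real K"
      using that \<alpha> by (intro mult_left_mono) auto
    finally have "real m * ?t \<le> \<delta>"
      using \<delta> by simp
    then have "real m * ?t / (1 + \<delta>) \<le> real m * ?t / (1 + real m * ?t)"
      using t \<delta>0 by (intro divide_left_mono mult_pos_pos add_pos_nonneg mult_nonneg_nonneg) (use \<alpha> in auto)
    also have "\<dots> \<le> 1 - (1 - ?t) ^ m"
      using t by (rule one_minus_power_ge)
    also have "\<dots> = prob (E k)"
      using prob_ex_le_PiM_unif[of "{1..m}" ?t] t by (simp add: E_def)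
    finally show ?thesis .
  qed
  \<comment> \<open>The sum is the harmonic number of K + 1 without its first term, hence the shift
    to K + 2 and the loss of 1.\<close>
  have "ln (real K + 2) - 1 \<le> (\<Sum>k=1..K. 1 / (real k + 1))"
  proof -
    have "ln (real (Suc K) + 1) \<le> harm (Suc K)"
      by (rule ln_le_harm)
    also have "harm (Suc K) = 1 + (\<Sum>k=Suc 1..Suc K. 1 / real k)"
      by (simp add: harm_def sum.atLeast_Suc_atMost inverse_eq_divide)
    also have "(\<Sum>k=Suc 1..Suc K. 1 / real k) = (\<Sum>k=1..K. 1 / (real k + 1))"
      by (subst sum.shift_bounds_cl_Suc_ivl) (simp add: add.commute)
    finally show ?thesis
      by (simp add: add.commute)
  qed
  then have "\<alpha> * (real m / real n) / (1 + \<delta>) * (ln (real K + 2) - 1)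
      \<le> \<alpha> * (real m / real n) / (1 + \<delta>) * (\<Sum>k=1..K. 1 / (real k + 1))"
    using \<alpha> \<delta>0 by (intro mult_left_mono) auto
  also have "\<dots> = (\<Sum>k=1..K. ?c k * (real m * (\<alpha> / real n * real k) / (1 + \<delta>)))"
    unfolding sum_distrib_left by (intro sum.cong) (auto simp: ac_simps)
  also have "\<dots> \<le> (\<Sum>k=1..K. ?c k * prob (E k))"
    by (intro sum_mono mult_left_mono prob_E) auto
  also have "\<dots> = expectation (\<lambda>\<omega>. \<Sum>k=1..K. ?c k * indicator (E k) \<omega>)"
    by (subst Bochner_Integration.integral_sum[OF int]) (simp only: integral_mult_right_zero prob_E_eq)
  also have "\<dots> \<le> expectation (\<lambda>\<omega>. BH_FDP n \<alpha> {1..m} (\<lambda>i. ?p i \<omega>))"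
  proof (rule integral_mono)
    show "integrable ?P (\<lambda>\<omega>. \<Sum>k=1..K. ?c k * indicator (E k) \<omega>)"
      by (rule Bochner_Integration.integrable_sum[OF int])
    have "\<And>i. i \<in> {1..n} \<Longrightarrow> ?p i \<in> borel_measurable ?P"
      using p_values_adversarial[of m n "\<alpha> / real n"] m n by (auto simp: p_values_def)
    then show "integrable ?P (\<lambda>\<omega>. BH_FDP n \<alpha> {1..m} (\<lambda>i. ?p i \<omega>))"
      by (intro integrable_const_bound[where B = "real n"] borel_measurable_BH_FDP)
         (auto simp: BH_FDP_nonneg BH_FDP_le)
    fix \<omega> assume "\<omega> \<in> space ?P"
    then have "(\<Sum>k=1..K. ?c k * indicator (E k) \<omega>) =
        (\<Sum>k=1..K. ?c k * of_bool (\<exists>j\<in>{1..m}. \<omega> j \<le> \<alpha> / real n * real k))"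
      by (intro sum.cong) (auto simp: E_def indicator_def)
    also have "\<dots> \<le> BH_FDP n \<alpha> {1..m} (\<lambda>i. ?p i \<omega>)"
      by (rule BH_FDP_adversarial_ge[OF \<alpha> n])
    finally show "(\<Sum>k=1..K. ?c k * indicator (E k) \<omega>) \<le> BH_FDP n \<alpha> {1..m} (\<lambda>i. ?p i \<omega>)" .
  qed
  finally show ?thesis
    by (simp add: BH_FDR_def)
qed

section \<open>Choice of the constants\<close>

theorem theorem4:
  shows "\<forall>\<epsilon>::real. \<epsilon> > 0 \<longrightarrow>
    (\<exists>\<alpha>\<^sub>0::real. 0 < \<alpha>\<^sub>0 \<and> \<alpha>\<^sub>0 < 1 \<and>
      (\<forall>\<alpha>::real. 0 < \<alpha> \<and> \<alpha> < \<alpha>\<^sub>0 \<longrightarrow>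
        (\<exists>N::nat. \<forall>n\<ge>N.
          \<exists>(M :: (nat \<Rightarrow> real) measure) (N0 :: nat set) (p :: nat \<Rightarrow> (nat \<Rightarrow> real) \<Rightarrow> real).
            p_values M n N0 p \<and> PRDN M N0 p \<and>
            BH_FDR M n \<alpha> N0 p > (1 - \<epsilon>) * (\<alpha> + \<alpha> * ln (1 / \<alpha>)))))"
proof (intro allI impI)
  fix \<epsilon> :: real assume \<epsilon>: "\<epsilon> > 0"
  \<comment> \<open>Capping at 1 keeps the factors 1 - \<eta> and 1 - \<eta> / 2
    nonnegative.\<close>
  define \<eta> where "\<eta> = min \<epsilon> 1"
  define \<delta> where "\<delta> = \<eta> / 4"
  have \<eta>: "0 < \<eta>" "\<eta> \<le> 1" "\<eta> \<le> \<epsilon>"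
    using \<epsilon> by (auto simp: \<eta>_def)
  then have \<delta>: "0 < \<delta>" "\<delta> < 1"
    by (auto simp: \<delta>_def)
  \<comment> \<open>Replacing 1 + L by L + ln \<delta> - 1 loses 2 - ln \<delta>; beyond
    \<open>L0\<close> the slack \<eta> L / 2 exceeds this loss.\<close>
  define L0 where "L0 = 2 / \<eta> * (2 - ln \<delta>)"
  have ln\<delta>: "ln \<delta> < 0"
    using \<delta> by simp
  have L0: "0 < L0"
    unfolding L0_def using \<eta> ln\<delta> by (intro mult_pos_pos) auto
  show "\<exists>\<alpha>\<^sub>0::real. 0 < \<alpha>\<^sub>0 \<and> \<alpha>\<^sub>0 < 1 \<and>
      (\<forall>\<alpha>::real. 0 < \<alpha> \<and> \<alpha> < \<alpha>\<^sub>0 \<longrightarrow>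
        (\<exists>N::nat. \<forall>n\<ge>N.
          \<exists>(M :: (nat \<Rightarrow> real) measure) (N0 :: nat set) (p :: nat \<Rightarrow> (nat \<Rightarrow> real) \<Rightarrow> real).
            p_values M n N0 p \<and> PRDN M N0 p \<and>
            BH_FDR M n \<alpha> N0 p > (1 - \<epsilon>) * (\<alpha> + \<alpha> * ln (1 / \<alpha>))))"
  proof (rule exI[of _ "exp (- L0)"], intro conjI allI impI)
    fix \<alpha> :: real assume "0 < \<alpha> \<and> \<alpha> < exp (- L0)"
    then have \<alpha>: "0 < \<alpha>" "\<alpha> < exp (- L0)"
      by auto
    moreover have "exp (- L0) < 1"
      using L0 by simp
    ultimately have \<alpha>1: "\<alpha> < 1"
      by linarith
    define L where "L = ln (1 / \<alpha>)"
    have "ln \<alpha> < ln (exp (- L0))"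
      using \<alpha> by (subst ln_less_cancel_iff) auto
    then have L: "L0 < L"
      using \<alpha> by (simp add: L_def ln_div)
    \<comment> \<open>The largest number of non-nulls with \<alpha> K \<le> \<delta>.\<close>
    define K where "K = nat \<lfloor>\<delta> / \<alpha>\<rfloor>"
    have K: "real K \<le> \<delta> / \<alpha>" "\<delta> / \<alpha> \<le> real K + 2"
      using \<delta> \<alpha> unfolding K_def by (auto intro: of_nat_floor) linarith
    have bound: "(1 - \<epsilon>) * (1 + L) < (1 - \<eta> / 2) * (ln (real K + 2) - 1)"
    proof -
      have "ln (\<delta> / \<alpha>) \<le> ln (real K + 2)"
        using K \<delta> \<alpha> by (subst ln_le_cancel_iff) auto
      then have lnK: "L + ln \<delta> \<le> ln (real K + 2)"
        using \<delta> \<alpha> by (simp add: L_def ln_div)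
      have "(1 - \<epsilon>) * (1 + L) \<le> (1 - \<eta>) * (1 + L)"
        using \<eta> L L0 by (intro mult_right_mono) auto
      also have "\<dots> < (1 - \<eta> / 2) * (L + ln \<delta> - 1)"
      proof -
        have "2 - ln \<delta> < \<eta> / 2 * L"
          using L \<eta> by (simp add: L0_def field_simps)
        moreover have "0 \<le> \<eta> / 2 * (1 - ln \<delta>)"
          using \<eta> ln\<delta> by (intro mult_nonneg_nonneg) auto
        moreover have "(1 - \<eta> / 2) * (L + ln \<delta> - 1) - (1 - \<eta>) * (1 + L) =
            \<eta> / 2 * L + ln \<delta> - 2 + \<eta> + \<eta> / 2 * (1 - ln \<delta>)"
          by (simp add: field_simps)
        ultimately show ?thesis
          using \<eta> by linarith
      qed
      also have "\<dots> \<le> (1 - \<eta> / 2) * (ln (real K + 2) - 1)"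
        using lnK \<eta> by (intro mult_left_mono) auto
      finally show ?thesis .
    qed
    show "\<exists>N::nat. \<forall>n\<ge>N.
          \<exists>(M :: (nat \<Rightarrow> real) measure) (N0 :: nat set) (p :: nat \<Rightarrow> (nat \<Rightarrow> real) \<Rightarrow> real).
            p_values M n N0 p \<and> PRDN M N0 p \<and>
            BH_FDR M n \<alpha> N0 p > (1 - \<epsilon>) * (\<alpha> + \<alpha> * ln (1 / \<alpha>))"
    \<comment> \<open>This size leaves at least one null and makes the non-null fraction K / n at
      most \<delta>.\<close>
    proof (rule exI[of _ "K + 1 + nat \<lceil>real K / \<delta>\<rceil>"], intro allI impI)
      fix n assume N: "K + 1 + nat \<lceil>real K / \<delta>\<rceil> \<le> n"
      define m where "m = n - K"
      have n: "n = m + K" "0 < m"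
        using N by (auto simp: m_def)
      have "real K / \<delta> \<le> real n"
        using N by linarith
      then have mn: "1 - \<delta> \<le> real m / real n"
        using n \<delta> by (simp add: field_simps)
      let ?M = "PiM {1..m} (\<lambda>_. unif)" and ?p = "adversarial_p m (\<alpha> / real n)"
      \<comment> \<open>The sign is needed to multiply the comparison of prefactors by this
        logarithmic term.\<close>
      have pos: "0 < ln (real K + 2) - 1"
      proof (rule ccontr)
        assume "\<not> 0 < ln (real K + 2) - 1"
        then have "L + ln \<delta> \<le> 1"
          using K \<delta> \<alpha> ln_mono[of "\<delta> / \<alpha>" "real K + 2"] by (simp add: L_def ln_div)
        moreover have "2 - ln \<delta> \<le> L0"
          using \<eta> ln\<delta> mult_right_mono[of 1 "2 / \<eta>" "2 - ln \<delta>"] by (simp add: L0_def)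
        ultimately show False
          using L by linarith
      qed
      have "(1 - \<epsilon>) * (\<alpha> + \<alpha> * ln (1 / \<alpha>)) = \<alpha> * ((1 - \<epsilon>) * (1 + L))"
        by (simp add: L_def algebra_simps)
      also have "\<dots> < \<alpha> * ((1 - \<eta> / 2) * (ln (real K + 2) - 1))"
        using bound \<alpha> by simp
      also have "\<dots> \<le> \<alpha> * ((real m / real n) / (1 + \<delta>) * (ln (real K + 2) - 1))"
      proof -
        \<comment> \<open>Here \<delta> = \<eta> / 4 pays for both losses: (1 - 2 \<delta>)(1 +
          \<delta>) \<le> 1 - \<delta>.\<close>
        have "(1 - \<eta> / 2) * (1 + \<delta>) \<le> 1 - \<delta>"
          using \<delta> by (simp add: \<delta>_def algebra_simps)
        also have "\<dots> \<le> real m / real n"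
          by (rule mn)
        finally have "1 - \<eta> / 2 \<le> (real m / real n) / (1 + \<delta>)"
          using \<delta> by (subst pos_le_divide_eq) auto
        then show ?thesis
          using \<alpha> pos by (intro mult_left_mono mult_right_mono) auto
      qed
      also have "\<dots> = \<alpha> * (real m / real n) / (1 + \<delta>) * (ln (real K + 2) - 1)"
        by simp
      also have "\<dots> \<le> BH_FDR ?M n \<alpha> {1..m} ?p"
        using K \<alpha> by (intro BH_FDR_adversarial_ge \<alpha> \<alpha>1 n) (simp add: field_simps)
      finally have "(1 - \<epsilon>) * (\<alpha> + \<alpha> * ln (1 / \<alpha>)) < BH_FDR ?M n \<alpha> {1..m} ?p" .
      then show "\<exists>(M :: (nat \<Rightarrow> real) measure) (N0 :: nat set) (p :: nat \<Rightarrow> (nat \<Rightarrow> real) \<Rightarrow> real).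
            p_values M n N0 p \<and> PRDN M N0 p \<and>
            BH_FDR M n \<alpha> N0 p > (1 - \<epsilon>) * (\<alpha> + \<alpha> * ln (1 / \<alpha>))"
        using p_values_adversarial[of m n] PRDN_adversarial n by (intro exI conjI) auto
    qed
  qed (use L0 in auto)
qed

end
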